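(* Let $X\subseteq \mathbb{C}^n$ be an irreducible affine cone. Then \[ X^{*}\subseteq \mathrm{DI}(X)\subseteq X^{*}+(Q\cap X), \] where $X^{*}+(Q\cap X)=\{a+b: a\in X^*,\ b\in Q\cap X\}$.
   Context: Work over $\mathbb{C}^n$ with the standard symmetric bilinear form $(x|y)=\sum_{i=1}^n x_iy_i$, and let $Q=\{x\in\mathbb{C}^n:\sum_{i=1}^n x_i^2=0\}$ be the isotropic quadric. Let $X\subseteq\mathbb{C}^n$ be an irreducible variety of codimension $c$ with radical defining ideal $I$; $\mathrm{Jac}_x(I)$ is the Jacobian matrix of a generating set of $I$ at $x$. $\mathrm{Sing}\,X$ is the set of $x\in X$ at which all $c\times c$ minors of $\mathrm{Jac}_x(I)$ vanish, and $X^{\mathrm{reg}}=X\setminus \mathrm{Sing}\,X$. The ED correspondence $\mathcal{E}_X\subseteq \mathbb{C}^n_u\times\mathbb{C}^n_x$ is the Zariski closure of the set of pairs $(u,x)$ with $u\in\mathbb{C}^n$, $x\in X^{\mathrm{reg}}$ and $\mathrm{rank}\begin{pmatrix}u-x\\ \mathrm{Jac}_x(I)\end{pmatrix}\le c$. Let $\pi_1,\pi_2$ be the projections of $\mathcal{E}_X$ to the $u$- and $x$-coordinates. The ED data isotropic locus is $\mathrm{DI}(X)=\pi_1(\mathcal{E}_X\cap\pi_2^{-1}(Q\cap X))$. The dual variety $X^{*}\subseteq\mathbb{C}^n$ is the Zariski closure of the set of $u\in\mathbb{C}^n$ such that $(u|v)=0$ for all $v\in T_xX$ for some $x\in X^{\mathrm{reg}}$.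 An affine cone is a variety stable under scaling, i.e. defined by homogeneous polynomials. *)

theory Defs
  imports "HOL-Analysis.Analysis"
begin

text \<open>The C-algebra of functions generated by constants and a given set of
  coordinate functions C.  For C = coordinate functions of C^n these are exactly
  the polynomial functions on C^n.\<close>
inductive_set poly_funs :: "('a \<Rightarrow> complex) set \<Rightarrow> ('a \<Rightarrow> complex) set"
  for C :: "('a \<Rightarrow> complex) set" where
  const: "(\<lambda>_. c) \<in> poly_funs C"
| coord: "f \<in> C \<Longrightarrow> f \<in> poly_funs C"
| add: "f \<in> poly_funs C \<Longrightarrow> g \<in> poly_funs C \<Longrightarrow> (\<lambda>x. f x + g x) \<in> poly_funs C"
| mult: "f \<in> poly_funs C \<Longrightarrow> g \<in> poly_funs C \<Longrightarrow> (\<lambda>x. f x * g x) \<in> poly_funs C"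

definition vec_coords :: "(complex^'n \<Rightarrow> complex) set" where
  "vec_coords = {(\<lambda>x. x $ i) | i. True}"

definition pair_coords :: "((complex^'n) \<times> (complex^'n) \<Rightarrow> complex) set" where
  "pair_coords = {(\<lambda>z. fst z $ i) | i. True} \<union> {(\<lambda>z. snd z $ i) | i. True}"

definition zariski_closed_in :: "('a \<Rightarrow> complex) set \<Rightarrow> 'a set \<Rightarrow> bool" where
  "zariski_closed_in C S \<longleftrightarrow> (\<exists>P \<subseteq> poly_funs C. S = {x. \<forall>p\<in>P. p x = 0})"

definition zariski_closure_in :: "('a \<Rightarrow> complex) set \<Rightarrow> 'a set \<Rightarrow> 'a set" where
  "zariski_closure_in C S = \<Inter>{T. zariski_closed_in C T \<and> S \<subseteq> T}"

abbreviation polys :: "(complex^'n \<Rightarrow> complex) set" where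
  "polys \<equiv> poly_funs vec_coords"

abbreviation zariski_closed :: "(complex^'n) set \<Rightarrow> bool" where
  "zariski_closed \<equiv> zariski_closed_in vec_coords"

abbreviation zariski_closure :: "(complex^'n) set \<Rightarrow> (complex^'n) set" where
  "zariski_closure \<equiv> zariski_closure_in vec_coords"

definition irreducible_variety :: "(complex^'n) set \<Rightarrow> bool" where
  "irreducible_variety X \<longleftrightarrow> zariski_closed X \<and> X \<noteq> {} \<and>
     (\<forall>A B. zariski_closed A \<longrightarrow> zariski_closed B \<longrightarrow> X = A \<union> B \<longrightarrow> X = A \<or> X = B)"

definition var_dim :: "(complex^'n) set \<Rightarrow> nat" where
  "var_dim X = Sup {k. \<exists>Y :: nat \<Rightarrow> (complex^'n) set.
      (\<forall>i\<le>k. irreducible_variety (Y i) \<and> Y i \<subseteq> X) \<and> (\<forall>i<k. Y i \<subset> Y (Suc i))}"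

definition codim :: "(complex^'n) set \<Rightarrow> nat" where
  "codim X = CARD('n) - var_dim X"

definition van_ideal :: "(complex^'n) set \<Rightarrow> (complex^'n \<Rightarrow> complex) set" where
  "van_ideal X = {p \<in> polys. \<forall>x\<in>X. p x = 0}"

definition grad :: "(complex^'n \<Rightarrow> complex) \<Rightarrow> complex^'n \<Rightarrow> complex^'n" where
  "grad p x = (\<chi> i. deriv (\<lambda>t::complex. p (x + t *s axis i 1)) 0)"

text \<open>Rows of the Jacobian matrix of the generating set I(X) of I(X) at x.\<close>
definition jac_rows :: "(complex^'n) set \<Rightarrow> complex^'n \<Rightarrow> (complex^'n) set" where
  "jac_rows X x = {grad p x | p. p \<in> van_ideal X}"

text \<open>All c x c minors vanish iff the rank (complex dimension of the row span) is < c.\<close>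
definition sing_locus :: "(complex^'n) set \<Rightarrow> (complex^'n) set" where
  "sing_locus X = {x \<in> X. vec.dim (jac_rows X x) < codim X}"

definition reg_locus :: "(complex^'n) set \<Rightarrow> (complex^'n) set" where
  "reg_locus X = X - sing_locus X"

definition bil :: "complex^'n \<Rightarrow> complex^'n \<Rightarrow> complex" where
  "bil x y = (\<Sum>i\<in>UNIV. x $ i * y $ i)"

definition iso_quadric :: "(complex^'n) set" where
  "iso_quadric = {x. (\<Sum>i\<in>UNIV. (x $ i)^2) = 0}"

definition ED_corr :: "(complex^'n) set \<Rightarrow> ((complex^'n) \<times> (complex^'n)) set" where
  "ED_corr X = zariski_closure_in pair_coords
     {(u, x). x \<in> reg_locus X \<and> vec.dim (insert (u - x) (jac_rows X x)) \<le> codim X}"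

definition DI :: "(complex^'n) set \<Rightarrow> (complex^'n) set" where
  "DI X = fst ` (ED_corr X \<inter> {(u, x). x \<in> iso_quadric \<inter> X})"

definition tangent_space :: "(complex^'n) set \<Rightarrow> complex^'n \<Rightarrow> (complex^'n) set" where
  "tangent_space X x = {v. \<forall>p\<in>van_ideal X. bil (grad p x) v = 0}"

definition dual_variety :: "(complex^'n) set \<Rightarrow> (complex^'n) set" where
  "dual_variety X = zariski_closure
     {u. \<exists>x\<in>reg_locus X. \<forall>v\<in>tangent_space X x. bil u v = 0}"

definition affine_cone :: "(complex^'n) set \<Rightarrow> bool" where
  "affine_cone X \<longleftrightarrow> (\<forall>x\<in>X. \<forall>t::complex. t *s x \<in> X)"

end

theory Submission
  imports Defs "HOL-Library.Function_Algebras"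
begin

text \<open>
  On a cone the Jacobian row space at \<open>t x\<close> equals that at \<open>x\<close>. If \<open>u\<close> is conormal at \<open>x\<close>, then
  \<open>(u + t x, t x)\<close> is an ED pair for every \<open>t \<noteq> 0\<close>, and \<open>t \<rightarrow> 0\<close> gives \<open>(u, 0)\<close>, hence the first inclusion.
  For the second, \<open>u - x\<close> is conormal at \<open>x\<close> for every ED pair \<open>(u, x)\<close>, and this passes to the closure.

  The first inclusion needs the Jacobian rank to be at most the codimension, where dimension means
  length of chains. A chain of length \<open>k\<close> gives \<open>k\<close> algebraically independent polynomials on \<open>X\<close>.
  The graph of these polynomials lives in dimension \<open>k + n\<close>, and adding the \<open>n\<close> coordinates one at a time
  to the \<open>k\<close> independent ones shows that its ideal is generated, after a localization, by at most \<open>n\<close>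
  elements. So its Jacobian has rank at most \<open>n\<close> generically; this rank is \<open>k\<close> plus that of \<open>X\<close>.
\<close>

section \<open>Polynomial functions and their derivatives\<close>

lemma poly_funs_uminus:
  assumes "f \<in> poly_funs C"
  shows "(\<lambda>x. - f x) \<in> poly_funs C"
  using poly_funs.mult[OF poly_funs.const[of "-1"] assms] by simp

lemma poly_funs_diff:
  assumes "f \<in> poly_funs C" "g \<in> poly_funs C"
  shows "(\<lambda>x. f x - g x) \<in> poly_funs C"
  using poly_funs.add[OF assms(1) poly_funs_uminus[OF assms(2)]] by simp

lemma poly_funs_power:
  assumes "f \<in> poly_funs C"
  shows "(\<lambda>x. f x ^ m) \<in> poly_funs C"
  by (induction m) (auto intro: poly_funs.const poly_funs.mult assms)

lemma poly_funs_sum: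
  assumes "\<And>i. i \<in> A \<Longrightarrow> f i \<in> poly_funs C"
  shows "(\<lambda>x. \<Sum>i\<in>A. f i x) \<in> poly_funs C"
  using assms
  by (induction A rule: infinite_finite_induct) (auto intro: poly_funs.const poly_funs.add)

lemma poly_funs_prod:
  assumes "\<And>i. i \<in> A \<Longrightarrow> f i \<in> poly_funs C"
  shows "(\<lambda>x. \<Prod>i\<in>A. f i x) \<in> poly_funs C"
  using assms
  by (induction A rule: infinite_finite_induct) (auto intro: poly_funs.const poly_funs.mult)

lemma poly_funs_compose:
  assumes "p \<in> poly_funs C" "\<And>c. c \<in> C \<Longrightarrow> (\<lambda>x. c (h x)) \<in> poly_funs D"
  shows "(\<lambda>x. p (h x)) \<in> poly_funs D"
  using assms(1) by induction (auto intro: poly_funs.intros assms(2))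

lemma poly_funs_mono:
  assumes "p \<in> poly_funs C" "C \<subseteq> D"
  shows "p \<in> poly_funs D"
  using poly_funs_compose[OF assms(1), of "\<lambda>x. x" D] assms(2) by (auto intro: poly_funs.coord)

lemma poly_funs_cong:
  assumes "p \<in> poly_funs C" "\<And>c. c \<in> C \<Longrightarrow> c x = c y"
  shows "p x = p y"
  using assms(1) by induction (auto simp: assms(2))

lemma poly_funs_curve_differentiable:
  assumes "p \<in> poly_funs C"
    and "\<And>c. c \<in> C \<Longrightarrow> (\<lambda>t. c (\<gamma> t)) field_differentiable (at a)"
  shows "(\<lambda>t. p (\<gamma> t)) field_differentiable (at a)"
  using assms(1)
  by induction (auto intro: assms(2) field_differentiable_add field_differentiable_mult)

lemma polys_coord: "(\<lambda>x. x $ i) \<in> polys"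
  by (rule poly_funs.coord) (auto simp: vec_coords_def)

lemma pair_polys_fst: "(\<lambda>z. fst z $ i) \<in> poly_funs pair_coords"
  by (rule poly_funs.coord) (auto simp: pair_coords_def)

lemma pair_polys_snd: "(\<lambda>z. snd z $ i) \<in> poly_funs pair_coords"
  by (rule poly_funs.coord) (auto simp: pair_coords_def)

lemma polys_compose:
  fixes h :: "'a \<Rightarrow> complex^'n"
  assumes "p \<in> polys" "\<And>i. (\<lambda>x. h x $ i) \<in> poly_funs D"
  shows "(\<lambda>x. p (h x)) \<in> poly_funs D"
  using assms(1) by (rule poly_funs_compose) (auto simp: vec_coords_def assms(2))

lemma polys_scale:
  assumes "p \<in> polys"
  shows "(\<lambda>x. p (c *s x)) \<in> polys"
  using assms by (rule polys_compose) (auto intro: poly_funs.mult poly_funs.const polys_coord)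

lemma polys_curve_differentiable:
  fixes x y :: "complex^'n"
  assumes "p \<in> polys"
  shows "(\<lambda>t. p (x + t *s y)) field_differentiable (at a)"
  using assms
  by (rule poly_funs_curve_differentiable)
     (auto simp: vec_coords_def intro!: field_differentiable_add field_differentiable_mult
        field_differentiable_const field_differentiable_ident)

section \<open>Gradients of polynomial functions\<close>

lemma grad_const: "grad (\<lambda>_. c) x = 0"
  by (simp add: grad_def vec_eq_iff)

lemma grad_coord: "grad (\<lambda>x. x $ i) x = axis i 1"
proof -
  have "deriv (\<lambda>t. x $ i + t * c) 0 = c" for c
    by (rule DERIV_imp_deriv) (auto intro!: derivative_eq_intros)
  then show ?thesis
    by (simp add: grad_def vec_eq_iff) (auto simp: axis_def)
qed

lemma grad_add:
  assumes "f \<in> polys" "g \<in> polys"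
  shows "grad (\<lambda>x. f x + g x) x = grad f x + grad g x"
  by (simp add: grad_def vec_eq_iff deriv_add polys_curve_differentiable assms)

lemma grad_mult:
  assumes "f \<in> polys" "g \<in> polys"
  shows "grad (\<lambda>x. f x * g x) x = f x *s grad g x + g x *s grad f x"
  by (simp add: grad_def vec_eq_iff deriv_mult polys_curve_differentiable assms)

lemma grad_cmult:
  assumes "f \<in> polys"
  shows "grad (\<lambda>x. c * f x) x = c *s grad f x"
  using grad_mult[OF poly_funs.const assms, of c x] by (simp add: grad_const)

lemma grad_scale:
  assumes "p \<in> polys"
  shows "grad (\<lambda>y. p (c *s y)) x = c *s grad p (c *s x)"
proof -
  have "deriv (\<lambda>t. p (c *s (x + t *s axis i 1))) 0 = c * deriv (\<lambda>t. p (c *s x + t *s axis i 1)) 0" for i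
  proof -
    let ?f = "\<lambda>t. p (c *s x + t *s axis i 1)"
    \<comment> \<open>The base point is written \<open>c * 0\<close> because the chain rule wants
      the outer derivative at the image of 0 under multiplication by \<open>c\<close>.\<close>
    have "(?f has_field_derivative deriv ?f 0) (at (c * 0))"
      using polys_curve_differentiable[OF assms] by (simp add: field_differentiable_derivI)
    then have "((\<lambda>t. ?f (c * t)) has_field_derivative deriv ?f 0 * c) (at 0)"
      by (rule DERIV_chain2) (auto intro!: derivative_eq_intros)
    moreover have "?f (c * t) = p (c *s (x + t *s axis i 1))" for t
      by (simp add: vec.scale_right_distrib)
    ultimately show ?thesis
      by (simp add: DERIV_imp_deriv mult.commute)
  qed
  then show ?thesis by (simp add: grad_def vec_eq_iff)
qed

lemma grad_polys:
  assumes "p \<in> polys"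
  shows "(\<lambda>x. grad p x $ i) \<in> polys"
  using assms
proof induction
  case (coord f)
  then obtain j where "f = (\<lambda>x. x $ j)" by (auto simp: vec_coords_def)
  then show ?case by (auto simp: grad_coord intro: poly_funs.const)
qed (auto simp: grad_const grad_add grad_mult intro: poly_funs.intros)

section \<open>Irreducible varieties and algebraic independence\<close>

lemma zariski_closed_Int_zeros:
  assumes "zariski_closed_in C S" "p \<in> poly_funs C"
  shows "zariski_closed_in C {x \<in> S. p x = 0}"
proof -
  obtain P where "P \<subseteq> poly_funs C" "S = {x. \<forall>q\<in>P. q x = 0}"
    using assms(1) by (auto simp: zariski_closed_in_def)
  then show ?thesis
    unfolding zariski_closed_in_def using assms(2) by (intro exI[of _ "insert p P"]) auto
qed

text \<open>The zero loci of \<open>p\<close> and \<open>q\<close> on \<open>X\<close> are closed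
  and cover \<open>X\<close>, so irreducibility makes one of them all of \<open>X\<close>. This is
  the only form in which irreducibility enters later arguments about polynomials.\<close>

lemma irreducible_variety_prime:
  assumes "irreducible_variety X" "p \<in> polys" "q \<in> polys" "\<forall>x\<in>X. p x * q x = 0"
  shows "(\<forall>x\<in>X. p x = 0) \<or> (\<forall>x\<in>X. q x = 0)"
proof -
  have "zariski_closed X" using assms(1) by (simp add: irreducible_variety_def)
  note cl = zariski_closed_Int_zeros[OF this]
  have "X = {x \<in> X. p x = 0} \<union> {x \<in> X. q x = 0}" using assms(4) by auto
  then have "X = {x \<in> X. p x = 0} \<or> X = {x \<in> X. q x = 0}"
    using assms(1) cl[OF assms(2)] cl[OF assms(3)] unfolding irreducible_variety_def by blast
  then show ?thesis by blast
qed

text \<open>A single polynomial vanishing on \<open>S\<close> already cuts out a closed set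
  containing \<open>S\<close>, and every closed set is an intersection of such zero sets. Closures
  can thus be tested one polynomial at a time.\<close>

lemma zariski_closure_iff:
  "x \<in> zariski_closure_in C S \<longleftrightarrow> (\<forall>p\<in>poly_funs C. (\<forall>y\<in>S. p y = 0) \<longrightarrow> p x = 0)"
proof
  assume x: "x \<in> zariski_closure_in C S"
  show "\<forall>p\<in>poly_funs C. (\<forall>y\<in>S. p y = 0) \<longrightarrow> p x = 0"
  proof (intro ballI impI)
    fix p assume p: "p \<in> poly_funs C" "\<forall>y\<in>S. p y = 0"
    then have "zariski_closed_in C {x. p x = 0}"
      unfolding zariski_closed_in_def by (intro exI[of _ "{p}"]) auto
    then show "p x = 0" using x p(2) unfolding zariski_closure_in_def by blast
  qed
next
  assume *: "\<forall>p\<in>poly_funs C. (\<forall>y\<in>S. p y = 0) \<longrightarrow> p x = 0"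
  show "x \<in> zariski_closure_in C S"
    unfolding zariski_closure_in_def
  proof clarify
    fix T assume T: "zariski_closed_in C T" "S \<subseteq> T"
    then obtain P where P: "P \<subseteq> poly_funs C" "T = {x. \<forall>p\<in>P. p x = 0}"
      by (auto simp: zariski_closed_in_def)
    have "p x = 0" if "p \<in> P" for p
    proof -
      have "\<forall>y\<in>S. p y = 0" using that T(2) P(2) by blast
      then show ?thesis using * that P(1) by blast
    qed
    then show "x \<in> T" by (simp add: P(2))
  qed
qed

lemma zariski_closure_zero:
  assumes "x \<in> zariski_closure_in C S" "p \<in> poly_funs C" "\<And>y. y \<in> S \<Longrightarrow> p y = 0"
  shows "p x = 0"
  using assms(1)[unfolded zariski_closure_iff] assms(2,3) by simp

text \<open>Points are functions on an arbitrary index type, so that variables can be adjoined one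
  at a time by enlarging \<open>A\<close> without changing the ambient space.\<close>

definition var_polys :: "'v set \<Rightarrow> (('v \<Rightarrow> complex) \<Rightarrow> complex) set" where
  "var_polys A = poly_funs {(\<lambda>z. z i) | i. i \<in> A}"

lemma var_polys_coord: "i \<in> A \<Longrightarrow> (\<lambda>z. z i) \<in> var_polys A"
  unfolding var_polys_def by (rule poly_funs.coord) auto

lemma var_polys_mono: "p \<in> var_polys A \<Longrightarrow> A \<subseteq> B \<Longrightarrow> p \<in> var_polys B"
  unfolding var_polys_def by (erule poly_funs_mono) auto

lemma var_polys_UNIV: "p \<in> var_polys A \<Longrightarrow> p \<in> var_polys UNIV"
  by (erule var_polys_mono) simp

lemma var_polys_cong:
  assumes "p \<in> var_polys A" "\<And>i. i \<in> A \<Longrightarrow> z i = w i"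
  shows "p z = p w"
  using assms(1) unfolding var_polys_def by (rule poly_funs_cong) (auto simp: assms(2))

lemmas var_polys_intros =
  poly_funs.const[of _ "{(\<lambda>z. z i) | i. i \<in> A}" for A, folded var_polys_def]
  poly_funs.add[of _ "{(\<lambda>z. z i) | i. i \<in> A}" for A, folded var_polys_def]
  poly_funs.mult[of _ "{(\<lambda>z. z i) | i. i \<in> A}" for A, folded var_polys_def]
  poly_funs_power[of _ "{(\<lambda>z. z i) | i. i \<in> A}" for A, folded var_polys_def]
  poly_funs_diff[of _ "{(\<lambda>z. z i) | i. i \<in> A}" for A, folded var_polys_def]
  poly_funs_sum[of _ _ "{(\<lambda>z. z i) | i. i \<in> A}" for A, folded var_polys_def]

lemma sum_mult_powers:
  fixes f g :: "nat \<Rightarrow> complex"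
  shows "(\<Sum>i\<le>M. f i * x ^ i) * (\<Sum>j\<le>N. g j * x ^ j)
    = (\<Sum>l\<le>M+N. (\<Sum>(i,j)\<in>{(i,j). i \<le> M \<and> j \<le> N \<and> i + j = l}. f i * g j) * x ^ l)"
proof -
  let ?S = "{..M} \<times> {..N}"
  have "(\<Sum>i\<le>M. f i * x ^ i) * (\<Sum>j\<le>N. g j * x ^ j) = (\<Sum>(i,j)\<in>?S. f i * g j * x ^ (i + j))"
    by (simp add: sum_product sum.cartesian_product power_add mult_ac)
  also have "\<dots> = (\<Sum>l\<le>M+N. \<Sum>p | p \<in> ?S \<and> fst p + snd p = l. (case p of (i,j) \<Rightarrow> f i * g j * x ^ (i + j)))"
    by (rule sum.group[symmetric]) auto
  also have "\<dots> = (\<Sum>l\<le>M+N. (\<Sum>(i,j)\<in>{(i,j). i \<le> M \<and> j \<le> N \<and> i + j = l}. f i * g j) * x ^ l)"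
    unfolding sum_distrib_right by (intro sum.cong) auto
  finally show ?thesis .
qed

text \<open>A polynomial is read as a univariate one in the variable \<open>v\<close>. Only
  existence is claimed: \<open>v\<close> may lie in \<open>A\<close>, and coefficients of index
  above \<open>N\<close> are unconstrained.\<close>

lemma var_polys_expand:
  assumes "p \<in> var_polys (insert v A)"
  obtains a N where "\<And>i. a i \<in> var_polys A" "\<And>z. p z = (\<Sum>i\<le>N. a i z * z v ^ i)"
proof -
  have "\<exists>a N. (\<forall>i. a i \<in> var_polys A) \<and> (\<forall>z. p z = (\<Sum>i\<le>(N::nat). a i z * z v ^ i))"
    using assms unfolding var_polys_def[of "insert v A"]
  proof induction
    case (const c)
    show ?case
      by (rule exI[of _ "\<lambda>_ _. c"], rule exI[of _ 0]) (auto intro: var_polys_intros)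
  next
    case (coord f)
    then obtain i where i: "f = (\<lambda>z. z i)" "i \<in> insert v A" by auto
    show ?case
    proof (cases "i \<in> A")
      case True
      then show ?thesis
        by (intro exI[of _ "\<lambda>_. f"] exI[of _ 0]) (auto simp: i intro: var_polys_coord)
    next
      case False
      then show ?thesis using i
        by (intro exI[of _ "\<lambda>j z. if j = 1 then 1 else 0"] exI[of _ 1])
           (auto intro: var_polys_intros)
    qed
  next
    case (add f g)
    then obtain a M b N where
      a: "\<forall>i. a i \<in> var_polys A" "\<forall>z. f z = (\<Sum>i\<le>(M::nat). a i z * z v ^ i)" and
      b: "\<forall>i. b i \<in> var_polys A" "\<forall>z. g z = (\<Sum>i\<le>(N::nat). b i z * z v ^ i)" by blast
    \<comment> \<open>The cutoffs discard the unconstrained coefficients above each bound before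
      both sums are extended to \<open>M + N\<close>.\<close>
    define c where "c = (\<lambda>i z. (if i \<le> M then a i z else 0) + (if i \<le> N then b i z else 0))"
    have "c i \<in> var_polys A" for i
      unfolding c_def using a(1) b(1) by (cases "i \<le> M"; cases "i \<le> N") (auto intro: var_polys_intros)
    moreover have "f z + g z = (\<Sum>i\<le>M+N. c i z * z v ^ i)" for z
    proof -
      have "(\<Sum>i\<le>M. a i z * z v ^ i) = (\<Sum>i\<le>M+N. (if i \<le> M then a i z else 0) * z v ^ i)"
        by (rule sum.mono_neutral_cong_left) auto
      moreover have "(\<Sum>i\<le>N. b i z * z v ^ i) = (\<Sum>i\<le>M+N. (if i \<le> N then b i z else 0) * z v ^ i)"
        by (rule sum.mono_neutral_cong_left) auto
      ultimately show ?thesis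
        using a(2) b(2) by (simp add: c_def sum.distrib distrib_right)
    qed
    ultimately show ?case by (intro exI[of _ c] exI[of _ "M+N"]) auto
  next
    case (mult f g)
    then obtain a M b N where
      a: "\<forall>i. a i \<in> var_polys A" "\<forall>z. f z = (\<Sum>i\<le>(M::nat). a i z * z v ^ i)" and
      b: "\<forall>i. b i \<in> var_polys A" "\<forall>z. g z = (\<Sum>i\<le>(N::nat). b i z * z v ^ i)" by blast
    define c where "c = (\<lambda>l z. \<Sum>q\<in>{(i,j). i \<le> M \<and> j \<le> N \<and> i + j = l}. a (fst q) z * b (snd q) z)"
    have "c i \<in> var_polys A" for i
      unfolding c_def using a(1) b(1) by (intro var_polys_intros) auto
    moreover have "f z * g z = (\<Sum>i\<le>M+N. c i z * z v ^ i)" for z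
      using a(2) b(2) sum_mult_powers[of "\<lambda>i. a i z" "z v" M "\<lambda>i. b i z" N]
      by (simp add: c_def case_prod_unfold)
    ultimately show ?case by (intro exI[of _ c] exI[of _ "M+N"]) auto
  qed
  then show thesis using that by blast
qed

text \<open>The point over \<open>x\<close> of the graph of \<open>g\<close>, values first. All of
  the sequence \<open>g\<close> is carried along, so that the index type does not depend on the
  length of a chain.\<close>

definition graph_point :: "(nat \<Rightarrow> complex^'n \<Rightarrow> complex) \<Rightarrow> complex^'n \<Rightarrow> nat + 'n \<Rightarrow> complex" where
  "graph_point g x = case_sum (\<lambda>i. g i x) (\<lambda>j. x $ j)"

lemma graph_point_simps [simp]:
  "graph_point g x (Inl i) = g i x"
  "graph_point g x (Inr j) = x $ j"
  by (simp_all add: graph_point_def)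

lemma var_polys_graph_point:
  fixes A :: "(nat + 'n::finite) set" and g :: "nat \<Rightarrow> complex^'n \<Rightarrow> complex"
  assumes "p \<in> var_polys A" "\<And>i. Inl i \<in> A \<Longrightarrow> g i \<in> polys"
  shows "(\<lambda>x. p (graph_point g x)) \<in> polys"
  using assms(1) unfolding var_polys_def
proof (rule poly_funs_compose)
  fix c assume "c \<in> {\<lambda>z::nat + 'n \<Rightarrow> complex. z i |i. i \<in> A}"
  then obtain i where i: "c = (\<lambda>z. z i)" "i \<in> A" by auto
  then show "(\<lambda>x. c (graph_point g x)) \<in> polys"
    using assms(2) by (cases i) (auto intro: polys_coord)
qed

text \<open>Each strict inclusion supplies a polynomial \<open>h\<close> vanishing on the smaller
  variety but not on the larger. In a relation involving \<open>h\<close> on the larger variety,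
  powers of \<open>h\<close> can be cancelled; restricting to the smaller one then leaves a relation
  among the earlier polynomials.\<close>

lemma chain_algebraically_independent:
  fixes Y :: "nat \<Rightarrow> (complex^'n) set"
  assumes "\<forall>i\<le>k. irreducible_variety (Y i)" "\<forall>i<k. Y i \<subset> Y (Suc i)"
  shows "\<exists>g. (\<forall>i. g i \<in> polys) \<and>
    (\<forall>p\<in>var_polys (Inl ` {..<k}). (\<forall>y\<in>Y k. p (graph_point g y) = 0) \<longrightarrow> (\<forall>z. p z = 0))"
  using assms
proof (induction k)
  case 0
  then have ne: "Y 0 \<noteq> {}" by (simp add: irreducible_variety_def)
  have "\<forall>z. p z = 0"
    if "p \<in> var_polys (Inl ` {..<0})" "\<forall>y\<in>Y 0. p (graph_point (\<lambda>_ _. 0) y) = 0"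
    for p :: "(nat + 'n \<Rightarrow> complex) \<Rightarrow> complex"
  proof
    fix z
    obtain y where "y \<in> Y 0" using ne by blast
    moreover have "p z = p (graph_point (\<lambda>_ _. 0) y)"
      using that(1) by (rule var_polys_cong) simp
    ultimately show "p z = 0" using that(2) by simp
  qed
  then show ?case by (intro exI[of _ "\<lambda>_ _. 0"]) (auto intro: poly_funs.const)
next
  case (Suc k)
  have "\<forall>i\<le>k. irreducible_variety (Y i)" "\<forall>i<k. Y i \<subset> Y (Suc i)"
    using Suc.prems by simp_all
  from Suc.IH[OF this] obtain g where g: "\<forall>i. g i \<in> polys"
    and indep: "\<And>p. p \<in> var_polys (Inl ` {..<k}) \<Longrightarrow> \<forall>y\<in>Y k. p (graph_point g y) = 0 \<Longrightarrow> \<forall>z. p z = 0"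
    by blast
  have irr: "irreducible_variety (Y (Suc k))" and sub: "Y k \<subset> Y (Suc k)"
    and cl: "zariski_closed (Y k)" using Suc.prems by (auto simp: irreducible_variety_def)
  obtain h y1 where h: "h \<in> polys" "\<forall>y\<in>Y k. h y = 0" "y1 \<in> Y (Suc k)" "h y1 \<noteq> 0"
    using cl sub unfolding zariski_closed_in_def by blast
  define g' where "g' = g(k := h)"
  have g': "g' i \<in> polys" for i
    using g h(1) by (auto simp: g'_def)
  have same: "p (graph_point g' y) = p (graph_point g y)" if "p \<in> var_polys (Inl ` {..<k})" for p y
    using that by (rule var_polys_cong) (auto simp: g'_def)
  have "\<forall>z. p z = 0"
    if p: "p \<in> var_polys (Inl ` {..<Suc k})" and van: "\<forall>y\<in>Y (Suc k). p (graph_point g' y) = 0" for p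
  proof -
    have "p \<in> var_polys (insert (Inl k) (Inl ` {..<k}))"
      using p by (simp add: lessThan_Suc)
    then obtain a N where a: "\<And>i. a i \<in> var_polys (Inl ` {..<k})"
      and pa: "\<And>z. p z = (\<Sum>i\<le>N. a i z * z (Inl k) ^ i)"
      by (rule var_polys_expand) blast
    have a_pol: "(\<lambda>x. a i (graph_point g' x)) \<in> polys" for i
      by (rule var_polys_graph_point[OF a]) (use g' in auto)
    have "\<forall>z. a m z = 0" if "m \<le> N" for m
      using that
    proof (induction m rule: less_induct)
      case (less m)
      \<comment> \<open>With all coefficients below \<open>m\<close> known to be zero,
        \<open>r\<close> is the relation divided by \<open>h ^ m\<close>; primality allows this
        since \<open>h\<close> is nonzero at \<open>y1\<close>.\<close>
      define r where "r = (\<lambda>x. \<Sum>i=m..N. a i (graph_point g' x) * h x ^ (i - m))"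
      have r: "r \<in> polys"
        unfolding r_def by (intro poly_funs_sum poly_funs.mult poly_funs_power a_pol h)
      have "h y ^ m * r y = 0" if y: "y \<in> Y (Suc k)" for y
      proof -
        have "0 = (\<Sum>i\<le>N. a i (graph_point g' y) * h y ^ i)"
          using van y pa by (simp add: g'_def)
        also have "\<dots> = (\<Sum>i=m..N. a i (graph_point g' y) * h y ^ i)"
          using less by (intro sum.mono_neutral_right) auto
        also have "\<dots> = h y ^ m * r y"
          unfolding r_def sum_distrib_left
          by (intro sum.cong) (auto simp: power_add[symmetric] mult.left_commute)
        finally show ?thesis by simp
      qed
      then have "(\<forall>y\<in>Y (Suc k). h y ^ m = 0) \<or> (\<forall>y\<in>Y (Suc k). r y = 0)"
        by (intro irreducible_variety_prime[OF irr] poly_funs_power r h) auto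
      then have "\<forall>y\<in>Y (Suc k). r y = 0" using h by auto
      \<comment> \<open>On \<open>Y k\<close> every positive power of \<open>h\<close> vanishes, and
        \<open>0 ^ 0 = 1\<close> keeps exactly the term \<open>i = m\<close>.\<close>
      moreover have "r y = a m (graph_point g y)" if "y \<in> Y k" for y
      proof -
        have "r y = (\<Sum>i\<in>{m}. a i (graph_point g' y) * h y ^ (i - m))"
          unfolding r_def using less.prems that h(2) by (intro sum.mono_neutral_right) auto
        then show ?thesis using same[OF a] by simp
      qed
      ultimately have "\<forall>y\<in>Y k. a m (graph_point g y) = 0"
        using sub by (metis psubsetD)
      then show ?case by (rule indep[OF a])
    qed
    then show ?thesis by (simp add: pa)
  qed
  then show ?case using g' by (intro exI[of _ g']) auto
qed

section \<open>Generators of a localized vanishing ideal\<close>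

text \<open>\<open>comb_of Fs\<close> is the ideal generated by \<open>Fs\<close>, and \<open>loc_comb_of s Fs\<close> the preimage of its
  localization at \<open>s\<close>.\<close>

definition comb_of ::
  "(('v \<Rightarrow> complex) \<Rightarrow> complex) set \<Rightarrow> (('v \<Rightarrow> complex) \<Rightarrow> complex) \<Rightarrow> bool" where
  "comb_of Fs p \<longleftrightarrow>
     (\<exists>q. (\<forall>F\<in>Fs. q F \<in> var_polys UNIV) \<and> (\<forall>z. p z = (\<Sum>F\<in>Fs. q F z * F z)))"

lemma comb_of_zero: "\<forall>z. p z = 0 \<Longrightarrow> comb_of Fs p"
  unfolding comb_of_def by (intro exI[of _ "\<lambda>_ _. 0"]) (auto intro: var_polys_intros)

lemma comb_of_member:
  assumes "finite Fs" "F \<in> Fs"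
  shows "comb_of Fs F"
  unfolding comb_of_def
proof (intro exI[of _ "\<lambda>G z. if G = F then 1 else 0"] conjI ballI allI)
  fix G show "(\<lambda>z::'a \<Rightarrow> complex. if G = F then 1 else 0::complex) \<in> var_polys UNIV"
    by (cases "G = F") (auto intro: var_polys_intros)
next
  fix z
  have "(\<Sum>G\<in>Fs. (if G = F then 1 else 0) * G z) = (\<Sum>G\<in>{F}. (if G = F then 1 else 0) * G z)"
    using assms by (intro sum.mono_neutral_right) auto
  then show "F z = (\<Sum>G\<in>Fs. (if G = F then 1 else 0) * G z)" by simp
qed

lemma comb_of_add:
  assumes "comb_of Fs p" "comb_of Fs r"
  shows "comb_of Fs (\<lambda>z. p z + r z)"
proof -
  obtain q q' where "\<forall>F\<in>Fs. q F \<in> var_polys UNIV" "\<forall>z. p z = (\<Sum>F\<in>Fs. q F z * F z)"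
    "\<forall>F\<in>Fs. q' F \<in> var_polys UNIV" "\<forall>z. r z = (\<Sum>F\<in>Fs. q' F z * F z)"
    using assms unfolding comb_of_def by blast
  then show ?thesis
    unfolding comb_of_def
    by (intro exI[of _ "\<lambda>F z. q F z + q' F z"])
       (auto simp: sum.distrib distrib_right intro: var_polys_intros)
qed

lemma comb_of_mult:
  assumes "comb_of Fs p" "r \<in> var_polys UNIV"
  shows "comb_of Fs (\<lambda>z. r z * p z)"
proof -
  obtain q where "\<forall>F\<in>Fs. q F \<in> var_polys UNIV" "\<forall>z. p z = (\<Sum>F\<in>Fs. q F z * F z)"
    using assms(1) unfolding comb_of_def by blast
  then show ?thesis
    unfolding comb_of_def using assms(2)
    by (intro exI[of _ "\<lambda>F z. r z * q F z"])
       (auto simp: sum_distrib_left mult.assoc intro: var_polys_intros)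
qed

lemma comb_of_insert:
  assumes "comb_of Fs p" "finite Fs"
  shows "comb_of (insert G Fs) p"
proof -
  obtain q where q: "\<forall>F\<in>Fs. q F \<in> var_polys UNIV" "\<forall>z. p z = (\<Sum>F\<in>Fs. q F z * F z)"
    using assms(1) unfolding comb_of_def by blast
  define q' where "q' = (\<lambda>F z. if F \<in> Fs then q F z else 0)"
  have "q' F \<in> var_polys UNIV" for F
    unfolding q'_def using q(1) by (cases "F \<in> Fs") (auto intro: var_polys_intros)
  moreover have "p z = (\<Sum>F\<in>insert G Fs. q' F z * F z)" for z
  proof -
    have "(\<Sum>F\<in>insert G Fs. q' F z * F z) = (\<Sum>F\<in>Fs. q' F z * F z)"
      using assms(2) by (intro sum.mono_neutral_right) (auto simp: q'_def)
    also have "\<dots> = (\<Sum>F\<in>Fs. q F z * F z)" by (intro sum.cong) (auto simp: q'_def)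
    finally show ?thesis using q(2) by simp
  qed
  ultimately show ?thesis unfolding comb_of_def by (intro exI[of _ q']) auto
qed

definition loc_comb_of ::
  "(('v \<Rightarrow> complex) \<Rightarrow> complex) \<Rightarrow> (('v \<Rightarrow> complex) \<Rightarrow> complex) set \<Rightarrow>
   (('v \<Rightarrow> complex) \<Rightarrow> complex) \<Rightarrow> bool" where
  "loc_comb_of s Fs p \<longleftrightarrow> (\<exists>m. comb_of Fs (\<lambda>z. s z ^ m * p z))"

lemma loc_comb_of_comb: "comb_of Fs p \<Longrightarrow> loc_comb_of s Fs p"
  unfolding loc_comb_of_def by (intro exI[of _ 0]) simp

lemma loc_comb_of_add:
  assumes "loc_comb_of s Fs p" "loc_comb_of s Fs r" "s \<in> var_polys UNIV"
  shows "loc_comb_of s Fs (\<lambda>z. p z + r z)"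
proof -
  obtain m n where m: "comb_of Fs (\<lambda>z. s z ^ m * p z)" and n: "comb_of Fs (\<lambda>z. s z ^ n * r z)"
    using assms unfolding loc_comb_of_def by blast
  have "comb_of Fs (\<lambda>z. s z ^ n * (s z ^ m * p z) + s z ^ m * (s z ^ n * r z))"
    by (intro comb_of_add comb_of_mult[OF m] comb_of_mult[OF n] var_polys_intros assms)
  then show ?thesis
    unfolding loc_comb_of_def by (intro exI[of _ "m + n"]) (simp add: power_add algebra_simps)
qed

lemma loc_comb_of_mult:
  assumes "loc_comb_of s Fs p" "r \<in> var_polys UNIV"
  shows "loc_comb_of s Fs (\<lambda>z. r z * p z)"
proof -
  obtain m where "comb_of Fs (\<lambda>z. s z ^ m * p z)"
    using assms unfolding loc_comb_of_def by blast
  from comb_of_mult[OF this assms(2)] show ?thesis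
    unfolding loc_comb_of_def by (intro exI[of _ m]) (simp add: mult.left_commute)
qed

lemma loc_comb_of_sum:
  assumes "\<And>i. i \<in> I \<Longrightarrow> loc_comb_of s Fs (p i)" "s \<in> var_polys UNIV"
  shows "loc_comb_of s Fs (\<lambda>z. \<Sum>i\<in>I. p i z)"
  using assms(1)
  by (induction I rule: infinite_finite_induct)
     (auto intro: loc_comb_of_comb comb_of_zero loc_comb_of_add assms(2))

lemma loc_comb_of_extend:
  assumes "loc_comb_of s Fs p" "finite Fs" "b \<in> var_polys UNIV"
  shows "loc_comb_of (\<lambda>z. s z * b z) (insert G Fs) p"
proof -
  obtain m where "comb_of Fs (\<lambda>z. s z ^ m * p z)"
    using assms unfolding loc_comb_of_def by blast
  then have "comb_of (insert G Fs) (\<lambda>z. b z ^ m * (s z ^ m * p z))"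
    by (intro comb_of_mult[OF comb_of_insert] var_polys_intros assms)
  then show ?thesis
    unfolding loc_comb_of_def by (intro exI[of _ m]) (simp add: power_mult_distrib mult_ac)
qed

text \<open>The factor \<open>b\<close> is a unit once \<open>s * b\<close> is inverted: one further
  factor \<open>s\<close> completes \<open>b\<close> to another power of
  \<open>s * b\<close>.\<close>

lemma loc_comb_of_cancel:
  assumes "loc_comb_of (\<lambda>z. s z * b z) Fs (\<lambda>z. b z * p z)" "s \<in> var_polys UNIV"
  shows "loc_comb_of (\<lambda>z. s z * b z) Fs p"
proof -
  obtain m where "comb_of Fs (\<lambda>z. (s z * b z) ^ m * (b z * p z))"
    using assms unfolding loc_comb_of_def by blast
  from comb_of_mult[OF this assms(2)] show ?thesis
    unfolding loc_comb_of_def by (intro exI[of _ "Suc m"]) (simp add: mult_ac)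
qed

lemma loc_ideal_generators_step:
  fixes Z :: "('v \<Rightarrow> complex) set"
  assumes prime: "\<And>p q. p \<in> var_polys UNIV \<Longrightarrow> q \<in> var_polys UNIV \<Longrightarrow> \<forall>z\<in>Z. p z * q z = 0 \<Longrightarrow>
      (\<forall>z\<in>Z. p z = 0) \<or> (\<forall>z\<in>Z. q z = 0)"
    and s: "s \<in> var_polys UNIV" "\<exists>z\<in>Z. s z \<noteq> 0"
    and Fs: "finite Fs" "Fs \<subseteq> var_polys UNIV" "\<forall>F\<in>Fs. \<forall>z\<in>Z. F z = 0"
    and gen: "\<And>p. p \<in> var_polys A \<Longrightarrow> \<forall>z\<in>Z. p z = 0 \<Longrightarrow> loc_comb_of s Fs p"
  shows "\<exists>s' Fs'. s' \<in> var_polys UNIV \<and> (\<exists>z\<in>Z. s' z \<noteq> 0) \<and> finite Fs' \<and> card Fs' \<le> Suc (card Fs) \<and>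
    Fs' \<subseteq> var_polys UNIV \<and> (\<forall>F\<in>Fs'. \<forall>z\<in>Z. F z = 0) \<and>
    (\<forall>p\<in>var_polys (insert v A). (\<forall>z\<in>Z. p z = 0) \<longrightarrow> loc_comb_of s' Fs' p)"
proof -
  \<comment> \<open>\<open>rel b e\<close>: \<open>b\<close> gives an algebraic relation of degree at most \<open>e\<close> for the coordinate \<open>v\<close> over
    those in \<open>A\<close>. Without one, \<open>Fs\<close> still suffices; otherwise one of least degree is added to \<open>Fs\<close>,
    its leading coefficient is inverted, and pseudo-division applies.\<close>
  define rel where "rel = (\<lambda>b e. (\<forall>i. b i \<in> var_polys A) \<and>
      (\<forall>z\<in>Z. (\<Sum>i\<le>e. b i z * z v ^ i) = 0) \<and> (\<exists>i\<le>(e::nat). \<exists>z\<in>Z. b i z \<noteq> 0))"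
  show ?thesis
  proof (cases "\<exists>e b. rel b e")
    case False
    have "loc_comb_of s Fs p" if p: "p \<in> var_polys (insert v A)" "\<forall>z\<in>Z. p z = 0" for p
    proof -
      obtain a N where a: "\<And>i. a i \<in> var_polys A" "\<And>z. p z = (\<Sum>i\<le>N. a i z * z v ^ i)"
        using p(1) by (rule var_polys_expand) blast
      have "\<forall>z\<in>Z. a i z = 0" if "i \<le> N" for i
      proof -
        have "\<not> rel a N" using False by blast
        moreover have "\<forall>z\<in>Z. (\<Sum>i\<le>N. a i z * z v ^ i) = 0" using p(2) a(2) by simp
        ultimately show ?thesis using a(1) that unfolding rel_def by blast
      qed
      then have "loc_comb_of s Fs (\<lambda>z. \<Sum>i\<le>N. z v ^ i * a i z)"
        using a(1) s(1)
        by (intro loc_comb_of_sum loc_comb_of_mult gen var_polys_intros var_polys_coord) auto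
      moreover have "p = (\<lambda>z. \<Sum>i\<le>N. z v ^ i * a i z)"
        by (simp add: fun_eq_iff a(2) mult.commute)
      ultimately show ?thesis by simp
    qed
    then show ?thesis using s Fs by (intro exI[of _ s] exI[of _ Fs]) auto
  next
    case True
    define e where "e = (LEAST e. \<exists>b. rel b e)"
    have "\<exists>b. rel b e" unfolding e_def using True by (rule LeastI_ex)
    then obtain b where b: "rel b e" ..
    have minimal: "\<not> rel a d" if "d < e" for a d
      using that not_less_Least unfolding e_def by blast
    have bA: "b i \<in> var_polys A" for i using b by (simp add: rel_def)
    \<comment> \<open>A sum over \<open>i < e\<close> would be a relation of degree at most
      \<open>e - 1\<close>, so minimality of \<open>e\<close> kills all its coefficients on
      \<open>Z\<close>.\<close>
    have low: "\<forall>z\<in>Z. a i z = 0"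
      if a: "\<And>i. a i \<in> var_polys A" "\<forall>z\<in>Z. (\<Sum>i<e. a i z * z v ^ i) = 0" and i: "i < e" for a i
    proof -
      obtain d where d: "e = Suc d" using i by (cases e) auto
      have "\<forall>z\<in>Z. (\<Sum>i\<le>d. a i z * z v ^ i) = 0"
        using a(2) unfolding d lessThan_Suc_atMost .
      then show ?thesis
        using minimal[of d a] a(1) i unfolding rel_def d less_Suc_eq_le by blast
    qed
    \<comment> \<open>If the leading coefficient vanished on \<open>Z\<close>, the rest would be a
      shorter relation and \<open>low\<close> would make \<open>b\<close> trivial. Hence
      \<open>b e\<close> may be inverted.\<close>
    have lead: "\<exists>z\<in>Z. b e z \<noteq> 0"
    proof (rule ccontr)
      assume *: "\<not> ?thesis"
      have "\<forall>z\<in>Z. (\<Sum>i<e. b i z * z v ^ i) = 0"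
      proof
        fix z assume z: "z \<in> Z"
        then have "(\<Sum>i\<le>e. b i z * z v ^ i) = 0" using b by (simp add: rel_def)
        then show "(\<Sum>i<e. b i z * z v ^ i) = 0"
          using * z by (simp add: lessThan_Suc_atMost[symmetric])
      qed
      from low[OF bA this] have "\<forall>i\<le>e. \<forall>z\<in>Z. b i z = 0"
        using * by (metis le_neq_implies_less)
      then show False using b by (auto simp: rel_def)
    qed
    define G where "G = (\<lambda>z. \<Sum>i\<le>e. b i z * z v ^ i)"
    define s' where "s' = (\<lambda>z. s z * b e z)"
    have bU: "b i \<in> var_polys UNIV" for i using bA by (rule var_polys_UNIV)
    have v_pow: "(\<lambda>z. z v ^ i) \<in> var_polys UNIV" for i
      by (intro var_polys_intros var_polys_coord) simp
    have G: "G \<in> var_polys UNIV" unfolding G_def by (intro var_polys_intros bU v_pow)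
    have G0: "\<forall>z\<in>Z. G z = 0" using b by (simp add: rel_def G_def)
    have s': "s' \<in> var_polys UNIV" unfolding s'_def by (intro var_polys_intros bU s)
    have s'_nz: "\<exists>z\<in>Z. s' z \<noteq> 0"
      using prime[OF s(1) bU[of e]] s(2) lead unfolding s'_def by (metis)
    have coeff: "loc_comb_of s' (insert G Fs) p" if "p \<in> var_polys A" "\<forall>z\<in>Z. p z = 0" for p
      unfolding s'_def using gen[OF that] Fs(1) bU by (rule loc_comb_of_extend)
    \<comment> \<open>Induction on the number \<open>N\<close> of coefficients: division by
      \<open>G\<close> lowers \<open>N\<close> as long as the degree is at least \<open>e\<close>;
      below that, \<open>low\<close> finishes.\<close>
    have gens: "loc_comb_of s' (insert G Fs) (\<lambda>z. \<Sum>i<N. a i z * z v ^ i)"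
      if "\<And>i. a i \<in> var_polys A" "\<forall>z\<in>Z. (\<Sum>i<N. a i z * z v ^ i) = 0" for a N
      using that
    proof (induction N arbitrary: a)
      case 0
      then show ?case by (intro loc_comb_of_comb comb_of_zero) auto
    next
      case (Suc N)
      show ?case
      proof (cases "N < e")
        case True
        \<comment> \<open>Padding with zeros up to length \<open>e\<close> brings the short sum into
          the form required by \<open>low\<close>.\<close>
        define a' where "a' = (\<lambda>i. if i \<le> N then a i else (\<lambda>_. 0))"
        have a': "a' i \<in> var_polys A" for i
          unfolding a'_def using Suc.prems(1) by (cases "i \<le> N") (auto intro: var_polys_intros)
        have "(\<Sum>i<e. a' i z * z v ^ i) = (\<Sum>i<Suc N. a i z * z v ^ i)" for z
          using True by (intro sum.mono_neutral_cong_right) (auto simp: a'_def)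
        then have "\<forall>z\<in>Z. (\<Sum>i<e. a' i z * z v ^ i) = 0" using Suc.prems(2) by simp
        from low[of a', OF a' this] have a'0: "\<forall>z\<in>Z. a' i z = 0" if "i < e" for i
          using that by blast
        have van: "\<forall>z\<in>Z. a i z = 0" if "i < Suc N" for i
          using a'0[of i] that True by (simp add: a'_def)
        have "loc_comb_of s' (insert G Fs) (\<lambda>z. \<Sum>i<Suc N. z v ^ i * a i z)"
          using s' Suc.prems(1) van by (intro loc_comb_of_sum loc_comb_of_mult coeff v_pow) auto
        then show ?thesis by (simp add: mult.commute)
      next
        case False
        \<comment> \<open>These are the coefficients of \<open>b e\<close> times the given
          polynomial minus \<open>a N * v ^ (N - e) * G\<close>; the one of index \<open>N\<close>
          cancels.\<close>
        define c where "c = (\<lambda>i z. b e z * a i z - (if N - e \<le> i then a N z * b (i - (N - e)) z else 0))"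
        have c: "c i \<in> var_polys A" for i
          unfolding c_def
          by (cases "N - e \<le> i") (simp_all, (intro var_polys_intros bA Suc.prems(1))+)
        have key: "b e z * (\<Sum>i<Suc N. a i z * z v ^ i)
            = (\<Sum>i<N. c i z * z v ^ i) + (a N z * z v ^ (N - e)) * G z" for z
        proof -
          have "(a N z * z v ^ (N - e)) * G z = (\<Sum>j\<le>e. a N z * b j z * z v ^ (N - e + j))"
            unfolding G_def sum_distrib_left by (intro sum.cong) (auto simp: power_add)
          also have "\<dots> = (\<Sum>i\<in>{N-e..N}. a N z * b (i - (N - e)) z * z v ^ i)"
            using False
            by (intro sum.reindex_bij_witness[of _ "\<lambda>i. i - (N - e)" "\<lambda>j. N - e + j"]) auto
          also have "\<dots> = (\<Sum>i<Suc N. (if N - e \<le> i then a N z * b (i - (N - e)) z else 0) * z v ^ i)"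
            by (intro sum.mono_neutral_cong_left) auto
          finally have "b e z * (\<Sum>i<Suc N. a i z * z v ^ i) - (a N z * z v ^ (N - e)) * G z
              = (\<Sum>i<Suc N. c i z * z v ^ i)"
            unfolding c_def sum_distrib_left by (simp only: left_diff_distrib sum_subtractf mult.assoc)
          moreover have "c N z = 0" using False by (simp add: c_def)
          ultimately show ?thesis by (simp add: algebra_simps)
        qed
        have "\<forall>z\<in>Z. (\<Sum>i<N. c i z * z v ^ i) = 0"
        proof
          fix z assume z: "z \<in> Z"
          show "(\<Sum>i<N. c i z * z v ^ i) = 0"
            using key[of z] Suc.prems(2) G0 z by simp
        qed
        from Suc.IH[OF c this]
        have low_part: "loc_comb_of s' (insert G Fs) (\<lambda>z. \<Sum>i<N. c i z * z v ^ i)" .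
        have "(\<lambda>z. a N z * z v ^ (N - e)) \<in> var_polys UNIV"
          by (rule var_polys_intros(3)[OF var_polys_UNIV[OF Suc.prems(1)] v_pow])
        moreover have "loc_comb_of s' (insert G Fs) G"
          using Fs(1) by (intro loc_comb_of_comb comb_of_member) auto
        ultimately have "loc_comb_of s' (insert G Fs) (\<lambda>z. (a N z * z v ^ (N - e)) * G z)"
          by (intro loc_comb_of_mult)
        from loc_comb_of_add[OF low_part this s']
        have "loc_comb_of s' (insert G Fs) (\<lambda>z. (\<Sum>i<N. c i z * z v ^ i) + (a N z * z v ^ (N - e)) * G z)" .
        then have "loc_comb_of (\<lambda>z. s z * b e z) (insert G Fs) (\<lambda>z. b e z * (\<Sum>i<Suc N. a i z * z v ^ i))"
          unfolding key s'_def .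
        then show ?thesis unfolding s'_def using s(1) by (rule loc_comb_of_cancel)
      qed
    qed
    have "loc_comb_of s' (insert G Fs) p" if p: "p \<in> var_polys (insert v A)" "\<forall>z\<in>Z. p z = 0" for p
    proof -
      obtain a N where a: "\<And>i. a i \<in> var_polys A" "\<And>z. p z = (\<Sum>i\<le>N. a i z * z v ^ i)"
        using p(1) by (rule var_polys_expand) blast
      have eq: "p = (\<lambda>z. \<Sum>i<Suc N. a i z * z v ^ i)"
        by (rule ext) (simp only: a(2) lessThan_Suc_atMost)
      show ?thesis using p(2) unfolding eq by (intro gens a)
    qed
    then show ?thesis using s' s'_nz Fs G G0
      by (intro exI[of _ s'] exI[of _ "insert G Fs"]) (auto simp: card_insert_if)
  qed
qed

lemma loc_ideal_generators:
  fixes Z :: "('v \<Rightarrow> complex) set"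
  assumes prime: "\<And>p q. p \<in> var_polys UNIV \<Longrightarrow> q \<in> var_polys UNIV \<Longrightarrow> \<forall>z\<in>Z. p z * q z = 0 \<Longrightarrow>
      (\<forall>z\<in>Z. p z = 0) \<or> (\<forall>z\<in>Z. q z = 0)"
    and "Z \<noteq> {}"
    and indep: "\<And>p. p \<in> var_polys A \<Longrightarrow> \<forall>z\<in>Z. p z = 0 \<Longrightarrow> \<forall>z. p z = 0"
    and "finite B"
  shows "\<exists>s Fs. s \<in> var_polys UNIV \<and> (\<exists>z\<in>Z. s z \<noteq> 0) \<and> finite Fs \<and> card Fs \<le> card B \<and>
    Fs \<subseteq> var_polys UNIV \<and> (\<forall>F\<in>Fs. \<forall>z\<in>Z. F z = 0) \<and>
    (\<forall>p\<in>var_polys (B \<union> A). (\<forall>z\<in>Z. p z = 0) \<longrightarrow> loc_comb_of s Fs p)"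
  using \<open>finite B\<close>
proof induction
  case empty
  have "loc_comb_of (\<lambda>_. 1) {} p" if "p \<in> var_polys A" "\<forall>z\<in>Z. p z = 0" for p
    using indep[OF that] by (intro loc_comb_of_comb comb_of_zero)
  then show ?case using \<open>Z \<noteq> {}\<close>
    by (intro exI[of _ "\<lambda>_. 1"] exI[of _ "{}"]) (auto intro: var_polys_intros)
next
  case (insert v B)
  then obtain s Fs where *: "s \<in> var_polys UNIV" "\<exists>z\<in>Z. s z \<noteq> 0" "finite Fs" "card Fs \<le> card B"
    "Fs \<subseteq> var_polys UNIV" "\<forall>F\<in>Fs. \<forall>z\<in>Z. F z = 0"
    "\<And>p. p \<in> var_polys (B \<union> A) \<Longrightarrow> \<forall>z\<in>Z. p z = 0 \<Longrightarrow> loc_comb_of s Fs p"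
    by blast
  obtain s' Fs' where "s' \<in> var_polys UNIV" "\<exists>z\<in>Z. s' z \<noteq> 0" "finite Fs'" "card Fs' \<le> Suc (card Fs)"
    "Fs' \<subseteq> var_polys UNIV" "\<forall>F\<in>Fs'. \<forall>z\<in>Z. F z = 0"
    "\<forall>p\<in>var_polys (insert v (B \<union> A)). (\<forall>z\<in>Z. p z = 0) \<longrightarrow> loc_comb_of s' Fs' p"
    using loc_ideal_generators_step[OF prime *(1,2,3,5,6,7), where v = v] by blast
  then show ?case using *(4) insert.hyps
    by (intro exI[of _ s'] exI[of _ Fs']) (auto intro: le_trans)
qed

section \<open>The dimension bound\<close>

text \<open>Gradients on the graph are indexed by the infinite type \<open>nat + 'n\<close>, so they
  are treated as functions in a space that may be infinite-dimensional.\<close>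

interpretation fun_vs: vector_space "\<lambda>(c::complex) (f::'v \<Rightarrow> complex) i. c * f i"
  by unfold_locales (auto simp: fun_eq_iff algebra_simps)

definition var_grad :: "(('v \<Rightarrow> complex) \<Rightarrow> complex) \<Rightarrow> ('v \<Rightarrow> complex) \<Rightarrow> 'v \<Rightarrow> complex" where
  "var_grad p z = (\<lambda>i. deriv (\<lambda>t. p (z(i := z i + t))) 0)"

lemma has_field_derivative_var_grad:
  assumes "p \<in> var_polys A"
  shows "((\<lambda>t. p (z(i := z i + t))) has_field_derivative var_grad p z i) (at 0)"
proof -
  have "(\<lambda>t. p (z(i := z i + t))) field_differentiable (at 0)"
    using assms unfolding var_polys_def
  proof (rule poly_funs_curve_differentiable)
    fix c assume "c \<in> {\<lambda>z::'a \<Rightarrow> complex. z i |i. i \<in> A}"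
    then obtain j where "c = (\<lambda>z. z j)" by auto
    then show "(\<lambda>t. c (z(i := z i + t))) field_differentiable (at 0)"
      by (cases "i = j")
         (auto intro: field_differentiable_add field_differentiable_const field_differentiable_ident)
  qed
  then show ?thesis unfolding var_grad_def by (rule field_differentiable_derivI)
qed

text \<open>Differentiate \<open>s ^ m * p = (\<Sum>F\<in>Fs. q F * F)\<close> at \<open>z\<close>.
  Since \<open>p\<close> and all \<open>F\<close> vanish there, the derivatives of
  \<open>s ^ m\<close> and of \<open>q F\<close> drop out, and \<open>s z ^ m\<close> can be divided
  away.\<close>

lemma var_grad_in_span:
  assumes "loc_comb_of s Fs p" "finite Fs" "Fs \<subseteq> var_polys UNIV" "s \<in> var_polys UNIV" "p \<in> var_polys UNIV"
    and "s z \<noteq> 0" "p z = 0" "\<forall>F\<in>Fs. F z = 0"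
  shows "var_grad p z \<in> fun_vs.span ((\<lambda>F. var_grad F z) ` Fs)"
proof -
  obtain m q where q: "\<forall>F\<in>Fs. q F \<in> var_polys UNIV"
    and eq: "\<forall>w. s w ^ m * p w = (\<Sum>F\<in>Fs. q F w * F w)"
    using assms(1) unfolding loc_comb_of_def comb_of_def by blast
  have main: "s z ^ m * var_grad p z i = (\<Sum>F\<in>Fs. q F z * var_grad F z i)" for i
  proof -
    let ?g = "\<lambda>t. z(i := z i + t)"
    have sm: "(\<lambda>w. s w ^ m) \<in> var_polys UNIV" using assms(4) by (rule var_polys_intros)
    have "((\<lambda>t. s (?g t) ^ m * p (?g t)) has_field_derivative s z ^ m * var_grad p z i) (at 0)"
      using DERIV_mult[OF has_field_derivative_var_grad[OF sm, of z i]
          has_field_derivative_var_grad[OF assms(5), of z i]] assms(7)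
      by (simp add: mult.commute)
    moreover have "((\<lambda>t. \<Sum>F\<in>Fs. q F (?g t) * F (?g t)) has_field_derivative
        (\<Sum>F\<in>Fs. q F z * var_grad F z i)) (at 0)"
    proof (rule DERIV_sum)
      fix F assume F: "F \<in> Fs"
      then have "q F \<in> var_polys UNIV" "F \<in> var_polys UNIV" "F z = 0" using q assms by auto
      then show "((\<lambda>t. q F (?g t) * F (?g t)) has_field_derivative q F z * var_grad F z i) (at 0)"
        using DERIV_mult[OF has_field_derivative_var_grad[of "q F" UNIV z i]
            has_field_derivative_var_grad[of F UNIV z i]]
        by (simp add: mult.commute)
    qed
    ultimately show ?thesis unfolding eq[rule_format] by (rule DERIV_unique)
  qed
  have sum_app: "(\<Sum>F\<in>Fs. (\<lambda>i. q F z / s z ^ m * var_grad F z i)) i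
      = (\<Sum>F\<in>Fs. q F z / s z ^ m * var_grad F z i)" for i
    using \<open>finite Fs\<close> by induction auto
  have "var_grad p z = (\<Sum>F\<in>Fs. (\<lambda>i. q F z / s z ^ m * var_grad F z i))"
  proof
    fix i
    show "var_grad p z i = (\<Sum>F\<in>Fs. (\<lambda>i. q F z / s z ^ m * var_grad F z i)) i"
      using main[of i] assms(6) unfolding sum_app
      by (simp add: field_simps sum_divide_distrib[symmetric])
  qed
  then show ?thesis
    by (simp only:) (intro fun_vs.span_sum fun_vs.span_scale fun_vs.span_base imageI)
qed

section \<open>Jacobian rank at a generic point\<close>

lemma polys_det:
  assumes "\<And>i j. (\<lambda>x. M x $ i $ j) \<in> polys"
  shows "(\<lambda>x. det (M x)) \<in> polys"
  unfolding det_def using assms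
  by (intro poly_funs_sum poly_funs.mult poly_funs_prod poly_funs.const)

lemma det_nz_of_independent_rows:
  fixes A :: "complex^'n^'n"
  assumes "inj f" "vec.independent (range f)" "\<And>i. row i A = f i"
  shows "det A \<noteq> 0"
proof -
  have "\<forall>i. c i = 0" if "(\<Sum>i\<in>UNIV. c i *s row i A) = 0" for c
  proof -
    have "(\<Sum>v\<in>range f. c (inv f v) *s v) = 0"
      using that assms(1,3) by (simp add: sum.reindex)
    then have "\<forall>v\<in>range f. c (inv f v) = 0"
      using assms(2)[unfolded vec.independent_explicit_finite_subsets, rule_format,
          of "range f" "\<lambda>v. c (inv f v)"] by simp
    then show ?thesis using assms(1) by auto
  qed
  then show ?thesis
    using invertible_det_nz invertible_right_inverse matrix_right_invertible_independent_rows by metis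
qed

text \<open>Moves the rank found at \<open>x1\<close> to a point where \<open>h\<close> is nonzero.
  This is needed because localized generators control gradients only where the localizing function
  does not vanish.\<close>

lemma jac_rows_dim_generic:
  fixes X :: "(complex^'n) set"
  assumes irr: "irreducible_variety X" and x1: "x1 \<in> X"
    and h: "h \<in> polys" "\<exists>x\<in>X. h x \<noteq> 0"
  obtains x0 and B :: "(complex^'n) set" and P where "x0 \<in> X" "h x0 \<noteq> 0" "card B = vec.dim (jac_rows X x1)"
    "\<And>v. v \<in> B \<Longrightarrow> P v \<in> van_ideal X" "inj_on (\<lambda>v. grad (P v) x0) B"
    "vec.independent ((\<lambda>v. grad (P v) x0) ` B)"
proof -
  obtain B where B: "B \<subseteq> jac_rows X x1" "vec.independent B" "card B = vec.dim (jac_rows X x1)"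
    by (rule vec.basis_exists)
  have "\<forall>v\<in>B. \<exists>p. p \<in> van_ideal X \<and> grad p x1 = v"
    using B(1) unfolding jac_rows_def by blast
  then obtain P where P: "\<And>v. v \<in> B \<Longrightarrow> P v \<in> van_ideal X" "\<And>v. v \<in> B \<Longrightarrow> grad (P v) x1 = v"
    by metis
  \<comment> \<open>Completing the gradients at \<open>x1\<close> by constant vectors gives a square matrix with polynomial entries
    whose determinant is nonzero at \<open>x1\<close>, hence at a generic point.\<close>
  define E where "E = vec.extend_basis B"
  have E: "B \<subseteq> E" "vec.independent E" "vec.span E = UNIV"
    unfolding E_def using B(2)
    by (auto simp: vec.extend_basis_superset vec.independent_extend_basis vec.span_extend_basis)
  have "finite E" using E(2) by (rule vec.finiteI_independent)
  moreover have "card E = CARD('n)"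
    using vec.dim_eq_card[of E UNIV] E(2,3) vec_dim_card by (metis vec.span_UNIV)
  ultimately obtain f where f: "bij_betw f (UNIV :: 'n set) E"
    by (metis finite_class.finite_UNIV finite_same_card_bij)
  define G where "G = (\<lambda>i x. if f i \<in> B then grad (P (f i)) x else f i)"
  define M where "M = (\<lambda>x. \<chi> i. G i x)"
  have row_M: "row i (M x) = G i x" for i x
    by (simp add: M_def row_def vec_eq_iff)
  have "(\<lambda>x. M x $ i $ j) \<in> polys" for i j
  proof (cases "f i \<in> B")
    case True
    then have "P (f i) \<in> polys" using P(1) by (simp add: van_ideal_def)
    then show ?thesis using True by (simp add: M_def G_def grad_polys)
  qed (simp add: M_def G_def poly_funs.const)
  then have det_M: "(\<lambda>x. det (M x)) \<in> polys" by (rule polys_det)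
  have "det (M x1) \<noteq> 0"
  proof (rule det_nz_of_independent_rows[of f])
    show "inj f" using f by (simp add: bij_betw_def)
    show "vec.independent (range f)" using f E(2) by (simp add: bij_betw_def)
    show "row i (M x1) = f i" for i using P(2) by (simp add: row_M G_def)
  qed
  then obtain x0 where x0: "x0 \<in> X" "h x0 \<noteq> 0" "det (M x0) \<noteq> 0"
    using irreducible_variety_prime[OF irr h(1) det_M] h(2) x1 by auto
  have img: "(\<lambda>v. grad (P v) x0) ` B \<subseteq> rows (M x0)"
  proof
    fix w assume "w \<in> (\<lambda>v. grad (P v) x0) ` B"
    then obtain v where v: "v \<in> B" "w = grad (P v) x0" by auto
    then obtain i where "v = f i" using f E(1) unfolding bij_betw_def by blast
    then have "w = row i (M x0)" using v by (simp add: row_M G_def)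
    then show "w \<in> rows (M x0)" by (auto simp: rows_def)
  qed
  \<comment> \<open>Independence of the image set would not notice coinciding gradients, so
    injectivity is what preserves the count \<open>card B\<close>.\<close>
  have "inj_on (\<lambda>v. grad (P v) x0) B"
  proof (rule inj_onI, rule ccontr)
    fix v w assume vw: "v \<in> B" "w \<in> B" "grad (P v) x0 = grad (P w) x0" "v \<noteq> w"
    then obtain i j where ij: "v = f i" "w = f j" using f E(1) unfolding bij_betw_def by blast
    then have "row i (M x0) = row j (M x0)" using vw by (simp add: row_M G_def)
    then show False using det_identical_rows[of i j "M x0"] x0(3) vw(4) ij by auto
  qed
  moreover have "vec.independent ((\<lambda>v. grad (P v) x0) ` B)"
    using det_dependent_rows x0(3) vec.independent_mono[OF _ img] by blast
  ultimately show thesis using x0(1,2) B(3) P(1) by (intro that[of x0 B P])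
qed

text \<open>The shape of the gradient of a polynomial that depends only on the original coordinates,
  with zeros in the graph variables.\<close>

definition inject_right :: "complex^'n \<Rightarrow> 'a + 'n \<Rightarrow> complex" where
  "inject_right v = case_sum (\<lambda>_. 0) (\<lambda>j. v $ j)"

lemma inject_right_simps [simp]:
  "inject_right v (Inl i) = 0"
  "inject_right v (Inr j) = v $ j"
  by (simp_all add: inject_right_def)

lemma inj_inject_right: "inj (inject_right :: complex^'n \<Rightarrow> 'a + 'n \<Rightarrow> complex)"
proof (rule injI)
  fix v w :: "complex^'n" assume "inject_right v = (inject_right w :: 'a + 'n \<Rightarrow> complex)"
  then show "v = w" by (metis inject_right_simps(2) vec_eq_iff)
qed

lemma independent_inject_right:
  fixes B :: "(complex^'n) set"
  assumes "vec.independent B"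
  shows "fun_vs.independent ((inject_right :: complex^'n \<Rightarrow> 'a + 'n \<Rightarrow> complex) ` B)"
proof -
  interpret vp: vector_space_pair "(*s) :: complex \<Rightarrow> complex^'n \<Rightarrow> complex^'n"
    "\<lambda>(c::complex) (f::'a + 'n \<Rightarrow> complex) i. c * f i" ..
  have "Vector_Spaces.linear (*s) (\<lambda>c (f::'a + 'n \<Rightarrow> complex) i. c * f i) inject_right"
    unfolding Vector_Spaces.linear_iff
    by (auto simp: fun_eq_iff inject_right_def vec.vector_space_axioms fun_vs.vector_space_axioms
        split: sum.split)
  then show ?thesis
    using assms inj_on_subset[OF inj_inject_right subset_UNIV]
    by (rule vp.linear_independent_injective_image)
qed

text \<open>A block triangular matrix: in column \<open>\<iota> k\<close> the row \<open>R k\<close>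
  has entry 1, while \<open>S\<close> and all earlier rows have 0, so \<open>R k\<close> is outside
  their span.\<close>

lemma independent_add_unit_rows:
  fixes R :: "nat \<Rightarrow> 'v \<Rightarrow> complex" and \<iota> :: "nat \<Rightarrow> 'v"
  assumes S: "fun_vs.independent S" "finite S" "\<And>f i. f \<in> S \<Longrightarrow> f (\<iota> i) = 0"
    and R: "\<And>i j. i < k \<Longrightarrow> R i (\<iota> j) = (if i = j then 1 else 0)"
  shows "fun_vs.independent (R ` {..<k} \<union> S) \<and> finite (R ` {..<k} \<union> S) \<and>
    card (R ` {..<k} \<union> S) = k + card S"
  using R
proof (induction k)
  case 0
  then show ?case using S by simp
next
  case (Suc k)
  let ?T = "R ` {..<k} \<union> S"
  have IH: "fun_vs.independent ?T \<and> finite ?T \<and> card ?T = k + card S" using Suc by simp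
  have vanish: "f (\<iota> k) = 0" if "f \<in> fun_vs.span ?T" for f
    using that
  proof (induction rule: fun_vs.span_induct_alt)
    case (step c f g)
    then show ?case using S(3) Suc.prems by auto
  qed simp
  have "R k (\<iota> k) \<noteq> 0" using Suc.prems[of k k] by simp
  then have notin_span: "R k \<notin> fun_vs.span ?T" using vanish[of "R k"] by linarith
  then have "R k \<notin> ?T" using fun_vs.span_base[of "R k" ?T] by metis
  moreover have "fun_vs.independent (insert (R k) ?T)"
    using IH by (intro fun_vs.independent_insertI notin_span) simp
  moreover have "R ` {..<Suc k} \<union> S = insert (R k) ?T" by (simp add: lessThan_Suc)
  ultimately show ?case using IH by simp
qed

lemma chain_length_add_jac_rank_le:
  fixes X :: "(complex^'n) set" and Y :: "nat \<Rightarrow> (complex^'n) set"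
  assumes irr: "irreducible_variety X" and x1: "x1 \<in> X"
    and Y: "\<forall>i\<le>k. irreducible_variety (Y i) \<and> Y i \<subseteq> X" "\<forall>i<k. Y i \<subset> Y (Suc i)"
  shows "k + vec.dim (jac_rows X x1) \<le> CARD('n)"
proof -
  have "\<forall>i\<le>k. irreducible_variety (Y i)" using Y(1) by simp
  from chain_algebraically_independent[OF this Y(2)]
  obtain g where g: "\<And>i. g i \<in> polys"
    and indep: "\<And>p. p \<in> var_polys (Inl ` {..<k}) \<Longrightarrow> \<forall>y\<in>Y k. p (graph_point g y) = 0 \<Longrightarrow> \<forall>z. p z = 0"
    by blast
  \<comment> \<open>The first \<open>k\<close> coordinates are independent on the graph \<open>Z\<close> of \<open>g\<close>, so its localized ideal needs only
    \<open>n\<close> generators, whereas its Jacobian contains the rows of \<open>z\<^sub>i - g\<^sub>i\<close> besides those of \<open>X\<close>.\<close>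
  define Z where "Z = graph_point g ` X"
  have pull: "(\<lambda>x. p (graph_point g x)) \<in> polys" if "p \<in> var_polys UNIV" for p
    using that g by (rule var_polys_graph_point)
  have prime: "(\<forall>z\<in>Z. p z = 0) \<or> (\<forall>z\<in>Z. q z = 0)"
    if "p \<in> var_polys UNIV" "q \<in> var_polys UNIV" "\<forall>z\<in>Z. p z * q z = 0" for p q
    using irreducible_variety_prime[OF irr pull[OF that(1)] pull[OF that(2)]] that(3)
    by (auto simp: Z_def)
  have "Z \<noteq> {}" using x1 by (auto simp: Z_def)
  \<comment> \<open>Independence was obtained on \<open>Y k\<close>; it passes to the graph over
    \<open>X\<close> because \<open>Y k\<close> lies in \<open>X\<close>.\<close>
  have indep_Z: "\<forall>z. p z = 0" if "p \<in> var_polys (Inl ` {..<k})" "\<forall>z\<in>Z. p z = 0" for p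
    using that Y(1) by (intro indep) (auto simp: Z_def)
  obtain s Fs where s: "s \<in> var_polys UNIV" "\<exists>z\<in>Z. s z \<noteq> 0"
    and Fs: "finite Fs" "card Fs \<le> card (range (Inr :: 'n \<Rightarrow> nat + 'n))" "Fs \<subseteq> var_polys UNIV"
      "\<forall>F\<in>Fs. \<forall>z\<in>Z. F z = 0"
    and gen: "\<And>p. p \<in> var_polys (range Inr \<union> Inl ` {..<k}) \<Longrightarrow> \<forall>z\<in>Z. p z = 0 \<Longrightarrow> loc_comb_of s Fs p"
    using loc_ideal_generators[where Z = Z and A = "Inl ` {..<k}" and B = "range Inr",
        OF prime \<open>Z \<noteq> {}\<close> indep_Z finite_imageI[OF finite]]
    by blast
  have "\<exists>x\<in>X. s (graph_point g x) \<noteq> 0" using s(2) by (simp add: Z_def)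
  from jac_rows_dim_generic[OF irr x1 pull[OF s(1)] this]
  obtain x0 and B :: "(complex^'n) set" and P where x0: "x0 \<in> X" "s (graph_point g x0) \<noteq> 0"
    and B: "card B = vec.dim (jac_rows X x1)" "\<And>v. v \<in> B \<Longrightarrow> P v \<in> van_ideal X"
      "inj_on (\<lambda>v. grad (P v) x0) B" "vec.independent ((\<lambda>v. grad (P v) x0) ` B)"
    by blast
  define z0 where "z0 = graph_point g x0"
  have z0: "z0 \<in> Z" "s z0 \<noteq> 0" using x0 by (auto simp: z0_def Z_def)
  define proj where "proj = (\<lambda>z::nat + 'n \<Rightarrow> complex. \<chi> j. z (Inr j))"
  let ?T = "(\<lambda>F. var_grad F z0) ` Fs"
  have in_span: "var_grad p z0 \<in> fun_vs.span ?T"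
    if "p \<in> var_polys (range Inr \<union> Inl ` {..<k})" "\<forall>z\<in>Z. p z = 0" for p
    using gen[OF that] Fs s(1) var_polys_UNIV[OF that(1)] z0 that(2)
    by (intro var_grad_in_span) auto
  have proj_poly: "(\<lambda>z. p (proj z)) \<in> var_polys (range Inr \<union> Inl ` {..<k})" if "p \<in> polys" for p
    using that unfolding var_polys_def
    by (rule polys_compose) (auto simp: proj_def intro!: poly_funs.coord)
  have [simp]: "proj (graph_point g x) = x" for x by (simp add: proj_def vec_eq_iff)
  have proj_z0: "proj z0 = x0" by (simp add: z0_def)
  have proj_Inl: "proj (z(Inl i := c)) = proj z" for z i c by (simp add: proj_def)
  have proj_Inr: "proj (z(Inr j := z (Inr j) + t)) = proj z + t *s axis j 1" for z j t
    by (auto simp: proj_def vec_eq_iff axis_def)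
  have grad_proj: "var_grad (\<lambda>z. p (proj z)) z0 = inject_right (grad p x0)" for p
  proof
    fix i show "var_grad (\<lambda>z. p (proj z)) z0 i = inject_right (grad p x0) i"
      by (cases i) (simp_all add: var_grad_def proj_Inl proj_Inr proj_z0 grad_def)
  qed
  define R where "R = (\<lambda>i. var_grad (\<lambda>z. z (Inl i) - g i (proj z)) z0)"
  have R_unit: "R i (Inl j) = (if i = j then 1 else 0)" for i j
  proof -
    \<comment> \<open>A move in direction \<open>Inl j\<close> leaves the projection fixed, so the
      value of \<open>g i\<close> is the constant \<open>c\<close>.\<close>
    have "((\<lambda>t. (z0(Inl j := z0 (Inl j) + t)) (Inl i) - c) has_field_derivative (if i = j then 1 else 0)) (at 0)" for c
      by (cases "i = j") (auto intro!: derivative_eq_intros)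
    then show ?thesis unfolding R_def var_grad_def proj_Inl by (rule DERIV_imp_deriv)
  qed
  have R_span: "R i \<in> fun_vs.span ?T" if "i < k" for i
    unfolding R_def
  proof (rule in_span)
    show "(\<lambda>z. z (Inl i) - g i (proj z)) \<in> var_polys (range Inr \<union> Inl ` {..<k})"
      using that by (intro var_polys_intros var_polys_coord proj_poly g) auto
  qed (auto simp: Z_def)
  define S where "S = (inject_right :: _ \<Rightarrow> nat + 'n \<Rightarrow> complex) ` (\<lambda>v. grad (P v) x0) ` B"
  have S_span: "S \<subseteq> fun_vs.span ?T"
  proof
    fix f assume "f \<in> S"
    then obtain v where v: "v \<in> B" "f = inject_right (grad (P v) x0)" by (auto simp: S_def)
    then have "P v \<in> polys" "\<forall>x\<in>X. P v x = 0" using B(2) by (auto simp: van_ideal_def)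
    then show "f \<in> fun_vs.span ?T"
      unfolding v(2) grad_proj[symmetric] by (intro in_span proj_poly) (auto simp: Z_def)
  qed
  have "fun_vs.independent S" unfolding S_def using B(4) by (rule independent_inject_right)
  moreover have finS: "finite S"
    unfolding S_def using vec.finiteI_independent[OF B(4)] by (rule finite_imageI)
  moreover have "f (Inl i) = 0" if "f \<in> S" for f i using that by (auto simp: S_def)
  ultimately have RS: "fun_vs.independent (R ` {..<k} \<union> S)" "card (R ` {..<k} \<union> S) = k + card S"
    using independent_add_unit_rows[of S Inl k R] R_unit by auto
  \<comment> \<open>Independent vectors in the span of the generators' gradients cannot outnumber
    those gradients.\<close>
  have "card (R ` {..<k} \<union> S) \<le> card ?T"
    using fun_vs.independent_span_bound[of ?T "R ` {..<k} \<union> S"] RS(1) R_span S_span Fs(1) by auto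
  also have "\<dots> \<le> card Fs" using Fs(1) by (rule card_image_le)
  also have "\<dots> \<le> CARD('n)" using Fs(2) by (simp add: card_image)
  finally have "k + card S \<le> CARD('n)" using RS(2) by simp
  moreover have "card S = card B"
    unfolding S_def using B(3) by (simp add: card_image inj_on_subset[OF inj_inject_right])
  ultimately show ?thesis using B(1) by simp
qed

lemma jac_rows_dim_le_codim:
  fixes X :: "(complex^'n) set"
  assumes irr: "irreducible_variety X" and x: "x \<in> X"
  shows "vec.dim (jac_rows X x) \<le> codim X"
proof -
  let ?K = "{k. \<exists>Y :: nat \<Rightarrow> (complex^'n) set.
      (\<forall>i\<le>k. irreducible_variety (Y i) \<and> Y i \<subseteq> X) \<and> (\<forall>i<k. Y i \<subset> Y (Suc i))}"
  have bound: "k + vec.dim (jac_rows X x) \<le> CARD('n)" if "k \<in> ?K" for k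
    using that chain_length_add_jac_rank_le[OF irr x] by blast
  \<comment> \<open>The chain consisting of \<open>X\<close> alone makes the set nonempty, as
    bounding its supremum requires.\<close>
  have "0 \<in> ?K" using irr by (intro CollectI exI[of _ "\<lambda>_. X"]) auto
  then have nonempty: "?K \<noteq> {}" by blast
  have "k \<le> CARD('n) - vec.dim (jac_rows X x)" if "k \<in> ?K" for k
    using bound[OF that] by linarith
  from cSup_least[OF nonempty this] have "var_dim X \<le> CARD('n) - vec.dim (jac_rows X x)"
    unfolding var_dim_def by blast
  \<comment> \<open>Without this, truncated subtraction of naturals would make the bound on
    \<open>var_dim X\<close> too weak.\<close>
  moreover have "vec.dim (jac_rows X x) \<le> CARD('n)" using bound[OF \<open>0 \<in> ?K\<close>] by simp
  ultimately show ?thesis unfolding codim_def by linarith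
qed

section \<open>Cones and the ED correspondence\<close>

text \<open>The polynomial \<open>t * p (inverse t *s y)\<close> again vanishes on the cone, and its
  factor \<open>t\<close> cancels the \<open>inverse t\<close> produced by the chain rule.\<close>

lemma jac_rows_scale_subset:
  fixes X :: "(complex^'n) set"
  assumes cone: "affine_cone X" and t: "t \<noteq> 0"
  shows "jac_rows X x \<subseteq> jac_rows X (t *s x)"
proof
  fix v assume "v \<in> jac_rows X x"
  then obtain p where p: "p \<in> polys" "\<forall>y\<in>X. p y = 0" "v = grad p x"
    by (auto simp: jac_rows_def van_ideal_def)
  define q where "q = (\<lambda>y. t * p (inverse t *s y))"
  have scaled: "(\<lambda>y. p (inverse t *s y)) \<in> polys" using p(1) by (rule polys_scale)
  then have "q \<in> polys" unfolding q_def by (intro poly_funs.mult poly_funs.const)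
  moreover have "\<forall>y\<in>X. q y = 0" using p(2) cone by (auto simp: q_def affine_cone_def)
  moreover have "grad q (t *s x) = v"
    unfolding q_def p(3) grad_cmult[OF scaled] grad_scale[OF p(1)]
    using t by (simp add: vec.scale_scale)
  ultimately show "v \<in> jac_rows X (t *s x)" by (auto simp: jac_rows_def van_ideal_def)
qed

lemma jac_rows_scale:
  fixes X :: "(complex^'n) set"
  assumes "affine_cone X" "t \<noteq> 0"
  shows "jac_rows X (t *s x) = jac_rows X x"
proof
  show "jac_rows X x \<subseteq> jac_rows X (t *s x)" using assms by (rule jac_rows_scale_subset)
  show "jac_rows X (t *s x) \<subseteq> jac_rows X x"
    using jac_rows_scale_subset[OF assms(1), of "inverse t" "t *s x"] assms(2)
    by (simp add: vec.scale_scale)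
qed

section \<open>Duality for the bilinear form and conormal vectors\<close>

lemma bil_add_left: "bil (u + v) w = bil u w + bil v w"
  by (simp add: bil_def sum.distrib distrib_right)

lemma bil_scale_left: "bil (c *s v) w = c * bil v w"
  by (simp add: bil_def sum_distrib_left mult.assoc)

lemma bil_span_eq_0:
  assumes "u \<in> vec.span S" "\<And>s. s \<in> S \<Longrightarrow> bil s w = 0"
  shows "bil u w = 0"
  using assms(1)
proof (induction rule: vec.span_induct_alt)
  case base
  show ?case by (simp add: bil_def)
next
  case (step c s v)
  then show ?case using assms(2) by (simp add: bil_add_left bil_scale_left)
qed

text \<open>A linear functional that is 1 at \<open>u\<close> and 0 on a basis of the span of
  \<open>S\<close> is represented by a vector through \<open>bil\<close>.\<close>

lemma bil_separates_span:
  fixes u :: "complex^'n"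
  assumes "u \<notin> vec.span S"
  obtains w where "\<And>s. s \<in> S \<Longrightarrow> bil s w = 0" "bil u w \<noteq> 0"
proof -
  obtain B where B: "B \<subseteq> S" "vec.independent B" "S \<subseteq> vec.span B"
    by (rule vec.maximal_independent_subset)
  have u: "u \<notin> vec.span B" using assms B(1) vec.span_mono by blast
  then have "vec.independent (insert u B)" using B(2) by (rule vec.independent_insertI)
  from vec.linear_independent_extend[OF this, of "\<lambda>v. if v = u then 1 else 0"]
  obtain L :: "complex^'n \<Rightarrow> complex^'n" where L: "Vector_Spaces.linear (*s) (*s) L"
    "\<And>v. v \<in> insert u B \<Longrightarrow> L v = (if v = u then 1 else 0)" by blast
  interpret L: Vector_Spaces.linear "(*s)" "(*s)" L by (rule L(1))
  \<comment> \<open>\<open>L\<close> takes values in the space itself and sends \<open>u\<close> to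
    the all-ones vector, so any coordinate \<open>j\<close> gives the functional.\<close>
  fix j :: 'n
  define w where "w = (\<chi> i. L (axis i 1) $ j)"
  have bil_w: "bil v w = L v $ j" for v
  proof -
    have "L v = L (\<Sum>i\<in>UNIV. v $ i *s axis i 1)" by (simp add: basis_expansion)
    also have "\<dots> = (\<Sum>i\<in>UNIV. v $ i *s L (axis i 1))" by (simp add: L.sum L.scale)
    finally show ?thesis by (simp add: bil_def w_def)
  qed
  have "bil s w = 0" if "s \<in> S" for s
  proof (rule bil_span_eq_0)
    show "s \<in> vec.span B" using that B(3) by blast
    show "bil b w = 0" if "b \<in> B" for b
      using that u vec.span_base[of b B] L(2)[of b] by (auto simp: bil_w)
  qed
  moreover have "bil u w \<noteq> 0" using L(2)[of u] by (simp add: bil_w)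
  ultimately show thesis by (rule that)
qed

text \<open>The tangent space is the orthogonal complement of the Jacobian rows, and the double
  complement is their span.\<close>

lemma conormal_in_span_jac_rows:
  assumes "\<forall>v\<in>tangent_space X x. bil u v = 0"
  shows "u \<in> vec.span (jac_rows X x)"
proof (rule ccontr)
  assume "u \<notin> vec.span (jac_rows X x)"
  then obtain w where w: "\<And>s. s \<in> jac_rows X x \<Longrightarrow> bil s w = 0" "bil u w \<noteq> 0"
    by (rule bil_separates_span) blast
  then have "w \<in> tangent_space X x" by (auto simp: tangent_space_def jac_rows_def)
  then show False using assms w(2) by blast
qed

text \<open>At a regular point the rank is already at least the codimension, so a row that keeps it
  within the codimension adds nothing to the span.\<close>

lemma ED_pair_conormal:
  assumes "x \<in> reg_locus X" "vec.dim (insert (u - x) (jac_rows X x)) \<le> codim X"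
  shows "\<forall>v\<in>tangent_space X x. bil (u - x) v = 0"
proof -
  have "codim X \<le> vec.dim (jac_rows X x)"
    using assms(1) by (auto simp: reg_locus_def sing_locus_def)
  then have "vec.span (jac_rows X x) = vec.span (insert (u - x) (jac_rows X x))"
    using assms(2) by (intro vec.dim_eq_span) auto
  then have u: "u - x \<in> vec.span (jac_rows X x)"
    using vec.span_base[OF insertI1, of "u - x" "jac_rows X x"] by blast
  show ?thesis
  proof
    fix v assume v: "v \<in> tangent_space X x"
    show "bil (u - x) v = 0"
      using u by (rule bil_span_eq_0) (use v in \<open>auto simp: tangent_space_def jac_rows_def\<close>)
  qed
qed

section \<open>The two inclusions\<close>

lemma dual_subset_DI:
  fixes X :: "(complex^'n) set"
  assumes irr: "irreducible_variety X" and cone: "affine_cone X"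
  shows "dual_variety X \<subseteq> DI X"
proof
  fix u assume u: "u \<in> dual_variety X"
  \<comment> \<open>Scaling any point by 0 puts the origin in \<open>X\<close>; it is isotropic and
    serves as the second component of the pair over \<open>u\<close>.\<close>
  obtain x0 where "x0 \<in> X" using irr by (auto simp: irreducible_variety_def)
  then have "0 *s x0 \<in> X" using cone unfolding affine_cone_def by blast
  then have zero: "0 \<in> iso_quadric \<inter> X" by (simp add: iso_quadric_def)
  have "(u, 0) \<in> ED_corr X"
    unfolding ED_corr_def zariski_closure_iff
  proof (intro ballI impI)
    fix f :: "(complex^'n) \<times> (complex^'n) \<Rightarrow> complex"
    assume f: "f \<in> poly_funs pair_coords"
      "\<forall>y\<in>{(u, x). x \<in> reg_locus X \<and> vec.dim (insert (u - x) (jac_rows X x)) \<le> codim X}. f y = 0"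
    have limit: "f (w, 0) = 0" if w: "x \<in> reg_locus X" "\<forall>v\<in>tangent_space X x. bil w v = 0" for w x
    proof -
      \<comment> \<open>The normal space is constant along the ray through \<open>x\<close>, so \<open>(w + t x, t x)\<close> lies in the
        correspondence for \<open>t \<noteq> 0\<close>.\<close>
      define F where "F = (\<lambda>t. f (w + t *s x, t *s x))"
      have "F field_differentiable (at 0)"
        unfolding F_def using f(1)
        by (rule poly_funs_curve_differentiable)
           (auto simp: pair_coords_def intro!: field_differentiable_add field_differentiable_mult
              field_differentiable_const field_differentiable_ident)
      then have "isCont F 0" by (rule field_differentiable_imp_continuous_at)
      then have lim: "(F \<longlongrightarrow> F 0) (at 0)" by (simp add: isCont_def)
      have "F t = 0" if t: "t \<noteq> 0" for t
      proof -
        have "x \<in> X" using w(1) by (simp add: reg_locus_def)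
        then have tx: "t *s x \<in> X" using cone by (simp add: affine_cone_def)
        note jac = jac_rows_scale[OF cone t, of x]
        have reg: "t *s x \<in> reg_locus X"
          using w(1) tx by (auto simp: reg_locus_def sing_locus_def jac)
        have "w \<in> vec.span (jac_rows X x)" using w(2) by (rule conormal_in_span_jac_rows)
        then have "vec.dim (insert w (jac_rows X x)) = vec.dim (jac_rows X x)"
          by (metis vec.dim_span vec.span_redundant)
        \<comment> \<open>Regularity bounds the rank only from below; this opposite bound is where
          the dimension theory is used.\<close>
        also have "\<dots> \<le> codim X" using irr \<open>x \<in> X\<close> by (rule jac_rows_dim_le_codim)
        finally show ?thesis
          using f(2) reg by (simp add: F_def jac)
      qed
      then have "eventually (\<lambda>t. F t = 0) (at 0)" by (simp add: eventually_at_filter)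
      then have "(F \<longlongrightarrow> 0) (at 0)" by (rule tendsto_eventually)
      then have "F 0 = 0" using lim by (intro tendsto_unique[of "at 0" F]) auto
      then show ?thesis by (simp add: F_def)
    qed
    \<comment> \<open>Vanishing at all conormal vectors \<open>w\<close> passes to \<open>u\<close>,
      which is only known to lie in their closure.\<close>
    have "(\<lambda>w. f (w, 0)) \<in> polys"
      using f(1)
      by (rule poly_funs_compose) (auto simp: pair_coords_def intro: polys_coord poly_funs.const)
    with u[unfolded dual_variety_def] show "f (u, 0) = 0"
      by (rule zariski_closure_zero) (use limit in auto)
  qed
  then show "u \<in> DI X"
    unfolding DI_def using zero by (intro image_eqI[of _ _ "(u, 0)"]) auto
qed

text \<open>Subtraction is a polynomial map sending the defining pairs to conormal vectors, so
  polynomials vanishing on the latter pull back to polynomials vanishing on the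
  correspondence.\<close>

lemma ED_corr_diff_in_dual:
  fixes X :: "(complex^'n) set"
  assumes "(u, x) \<in> ED_corr X"
  shows "u - x \<in> dual_variety X"
  unfolding dual_variety_def zariski_closure_iff
proof (intro ballI impI)
  fix p :: "complex^'n \<Rightarrow> complex"
  assume p: "p \<in> polys" "\<forall>y\<in>{u. \<exists>x\<in>reg_locus X. \<forall>v\<in>tangent_space X x. bil u v = 0}. p y = 0"
  have "(\<lambda>z. p (fst z - snd z)) \<in> poly_funs pair_coords"
    using p(1)
    by (rule polys_compose) (auto intro: poly_funs_diff pair_polys_fst pair_polys_snd)
  moreover have "p (fst z - snd z) = 0"
    if "z \<in> {(u, x). x \<in> reg_locus X \<and> vec.dim (insert (u - x) (jac_rows X x)) \<le> codim X}" for z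
  proof -
    obtain u x where z: "z = (u, x)" by (cases z)
    have "\<forall>v\<in>tangent_space X x. bil (u - x) v = 0"
      using that unfolding z by (intro ED_pair_conormal) auto
    moreover have "x \<in> reg_locus X" using that unfolding z by simp
    ultimately show ?thesis using p(2) unfolding z by auto
  qed
  ultimately have "p (fst (u, x) - snd (u, x)) = 0"
    by (rule zariski_closure_zero[OF assms[unfolded ED_corr_def]])
  then show "p (u - x) = 0" by simp
qed

theorem theorem2p2:
  fixes X :: "(complex^'n) set"
  assumes "irreducible_variety X" and "affine_cone X"
  shows "dual_variety X \<subseteq> DI X \<and>
         DI X \<subseteq> {a + b | a b. a \<in> dual_variety X \<and> b \<in> iso_quadric \<inter> X}"
proof
  show "dual_variety X \<subseteq> DI X" using assms by (rule dual_subset_DI)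
  show "DI X \<subseteq> {a + b | a b. a \<in> dual_variety X \<and> b \<in> iso_quadric \<inter> X}"
  proof
    fix u assume "u \<in> DI X"
    then obtain x where x: "(u, x) \<in> ED_corr X" "x \<in> iso_quadric \<inter> X" by (auto simp: DI_def)
    have "u = (u - x) + x" by simp
    then show "u \<in> {a + b | a b. a \<in> dual_variety X \<and> b \<in> iso_quadric \<inter> X}"
      using ED_corr_diff_in_dual[OF x(1)] x(2) by blast
  qed
qed

end
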